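(* Let $G$ and $H$ be strongly regular graphs on $n$ vertices, belonging to the families $\mathrm{srg}(n,d,\lambda,\mu)$ and $\mathrm{srg}(n,d',\lambda',\mu')$, respectively. If $H$ is a spanning subgraph of $G$, then $$\frac{d}{d'} \cdot \frac{\mu'-\lambda' + \sqrt{(\mu'-\lambda')^2 + 4(d'-\mu')}}{\mu-\lambda + \sqrt{(\mu-\lambda)^2 + 4(d-\mu)}} \geq 1.$$
   Context: All graphs are finite, simple and undirected. A $d$-regular graph on $n$ vertices is strongly regular, in the family $\mathrm{srg}(n,d,\lambda,\mu)$ with $\lambda,\mu$ nonnegative integers, if every pair of adjacent vertices has exactly $\lambda$ common neighbors and every pair of distinct nonadjacent vertices has exactly $\mu$ common neighbors. Complete graphs and empty (edgeless) graphs are excluded from the strongly regular graphs; disconnected graphs (with $\mu=0$) are allowed. A graph $H$ is a spanning subgraph of $G$ if $H$ and $G$ have the same vertex set and every edge of $H$ is an edge of $G$. *)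

theory Defs
  imports Complex_Main "Graph_Theory.Graph_Theory"
begin

text \<open>
  A finite simple undirected graph is a \<^locale>\<open>pair_graph\<close>: a finite, loopless, symmetric
  digraph without parallel arcs. An edge \<open>uv\<close> is the pair of arcs \<open>(u,v)\<close>, \<open>(v,u)\<close>, so the degree
  of a vertex in the undirected graph is its out-degree.
\<close>

definition common_neighbors :: "'a pair_pre_digraph \<Rightarrow> 'a \<Rightarrow> 'a \<Rightarrow> 'a set" where
  "common_neighbors G u v = {w \<in> pverts G. (u, w) \<in> parcs G \<and> (v, w) \<in> parcs G}"

definition regular_graph :: "nat \<Rightarrow> 'a pair_pre_digraph \<Rightarrow> bool" where
  "regular_graph d G \<longleftrightarrow> pair_graph G \<and> (\<forall>v \<in> pverts G. out_degree (with_proj G) v = d)"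

definition srg :: "nat \<Rightarrow> nat \<Rightarrow> nat \<Rightarrow> nat \<Rightarrow> 'a pair_pre_digraph \<Rightarrow> bool" where
  "srg n d lam mu G \<longleftrightarrow>
     regular_graph d G \<and> card (pverts G) = n \<and>
     \<not> complete_digraph n (with_proj G) \<and> parcs G \<noteq> {} \<and>
     (\<forall>u \<in> pverts G. \<forall>v \<in> pverts G.
        (u, v) \<in> parcs G \<longrightarrow> card (common_neighbors G u v) = lam) \<and>
     (\<forall>u \<in> pverts G. \<forall>v \<in> pverts G.
        u \<noteq> v \<and> (u, v) \<notin> parcs G \<longrightarrow> card (common_neighbors G u v) = mu)"

end

theory Submission
  imports Defs
begin

text \<open>
  Let \<open>\<theta> \<ge> 0 > \<tau>\<close> be the restricted eigenvalues of \<open>G\<close>, that is, the roots of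
  \<open>x\<^sup>2 - (\<lambda> - \<mu>) x - (d - \<mu>)\<close>, and \<open>\<theta>', \<tau>'\<close> those of \<open>H\<close>. The denominator in the claim is \<open>-2\<tau>\<close>
  and the numerator is \<open>-2\<tau>'\<close>, so the claim reads \<open>d / (-\<tau>) \<ge> d' / (-\<tau>')\<close>. Since the
  Lovasz theta number of the complement of a strongly regular graph is \<open>1 + d / (-\<tau>)\<close>, this is
  the monotonicity of theta under adding edges to \<open>H\<close>.

  The theta number itself can be avoided, because the optimal primal and dual matrices are known
  explicitly. Let \<open>A, A'\<close> be the adjacency matrices, \<open>I\<close> the identity and \<open>J\<close> the all-ones matrix.
  On the complement of the constant vector, \<open>Z = \<theta> I - A + (d - \<theta>)/n J\<close> is \<open>\<theta> - \<tau>\<close> times the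
  projection onto the \<open>\<tau>\<close>-eigenspace of \<open>G\<close>, and \<open>W = A' - \<tau>' I - (d' - \<tau>')/n J\<close> is \<open>\<theta>' - \<tau>'\<close>
  times the projection onto the \<open>\<theta>'\<close>-eigenspace of \<open>H\<close>; both annihilate the constant vector.
  The trace of \<open>Z W\<close> is therefore nonnegative (lemma \<open>projection_trace_sign\<close>). It can also be
  computed from the parameters, because the trace of \<open>A A'\<close> is \<open>n d'\<close> when every edge of \<open>H\<close> is an
  edge of \<open>G\<close> (lemma \<open>eig_matrix_inner_row\<close>). The identity \<open>(d - \<theta>) (d - \<tau>) = \<mu> n\<close> turns the
  resulting inequality into the claim.

  That \<open>Z\<close> and \<open>W\<close> are multiples of projections means that \<open>Z\<^sup>2\<close> and \<open>W\<^sup>2\<close> are multiples of \<open>Z\<close> and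
  \<open>W\<close>. This follows from the quadratic equation satisfied by an adjacency matrix, so that the whole
  argument consists of finite sums over the vertices.
\<close>

section \<open>The adjacency matrix of a strongly regular graph\<close>

lemma sum_Kronecker_delta:
  fixes f :: "'a \<Rightarrow> real"
  assumes "finite V" and "u \<in> V"
  shows "(\<Sum>v\<in>V. f v * of_bool (u = v)) = f u"
    and "(\<Sum>v\<in>V. of_bool (u = v) * f v) = f u"
  using assms by (simp_all add: of_bool_def if_distrib if_distribR cong: if_cong)

definition adj :: "'a pair_pre_digraph \<Rightarrow> 'a \<Rightarrow> 'a \<Rightarrow> real" where
  "adj G u v = of_bool ((u, v) \<in> parcs G)"

lemma adj_simps:
  assumes "pair_graph G"
  shows "adj G u v = adj G v u" and "adj G u u = 0"
proof -
  interpret pair_graph G by fact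
  show "adj G u v = adj G v u"
    using pair_sym_arcs unfolding adj_def symmetric_def by (auto dest: symD)
  show "adj G u u = 0"
    using pair_no_loops[of "(u, u)"] by (auto simp: adj_def)
qed

lemma adj_row_sum:
  assumes "srg n d lam mu G" and u: "u \<in> pverts G"
  shows "(\<Sum>v\<in>pverts G. adj G u v) = d"
proof -
  interpret pair_graph G using assms(1) by (simp add: srg_def regular_graph_def)
  have "out_arcs (with_proj G) u = Pair u ` {v \<in> pverts G. (u, v) \<in> parcs G}"
    by (auto simp: out_arcs_def dest: in_arcsD2)
  then have "card {v \<in> pverts G. (u, v) \<in> parcs G} = out_degree (with_proj G) u"
    by (simp add: out_degree_def card_image inj_on_def)
  also have "\<dots> = d"
    using assms by (simp add: srg_def regular_graph_def)
  finally show ?thesis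
    using pair_finite_verts by (simp add: adj_def of_bool_def sum.If_cases Int_def)
qed

text \<open>
  The entries of \<open>A\<^sup>2\<close> count common neighbours, so strong regularity says
  \<open>A\<^sup>2 = (\<lambda> - \<mu>) A + (d - \<mu>) I + \<mu> J\<close>.
\<close>

lemma adj_square:
  assumes "srg n d lam mu G" and u: "u \<in> pverts G" and v: "v \<in> pverts G"
  shows "(\<Sum>w\<in>pverts G. adj G u w * adj G v w) =
    (real lam - real mu) * adj G u v + (real d - real mu) * of_bool (u = v) + real mu"
proof -
  interpret pair_graph G using assms(1) by (simp add: srg_def regular_graph_def)
  have eq: "(\<Sum>w\<in>pverts G. adj G u w * adj G v w) = card (common_neighbors G u v)"
    using pair_finite_verts
    by (simp add: adj_def common_neighbors_def Int_def flip: of_bool_conj)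
  show ?thesis
  proof (cases "u = v")
    case True
    have "(\<Sum>w\<in>pverts G. adj G u w * adj G v w) = (\<Sum>w\<in>pverts G. adj G u w)"
      by (simp add: True adj_def flip: of_bool_conj)
    then show ?thesis
      using adj_row_sum[OF assms(1) u] adj_simps(2)[OF pair_graph_axioms] by (simp add: True)
  next
    case False
    then show ?thesis
      using assms unfolding eq by (auto simp: srg_def adj_def)
  qed
qed

text \<open>
  Common neighbours of \<open>u\<close> and \<open>v\<close> are neighbours of \<open>u\<close>, and if \<open>uv\<close> is an edge, \<open>v\<close> is a neighbour
  of \<open>u\<close> that is not common. The two bounds on the parameters \<open>\<lambda>\<close> and \<open>\<mu>\<close> need an edge and a
  nonadjacent pair to exist; these are supplied by the exclusion of empty and of complete graphs.
\<close>

lemma srg_bounds: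
  assumes "srg n d lam mu G"
  shows "lam < d" and "mu \<le> d" and "d < n"
proof -
  interpret pair_graph G using assms by (simp add: srg_def regular_graph_def)
  define N where "N u = {v \<in> pverts G. (u, v) \<in> parcs G}" for u
  have finN: "finite (N u)" for u
    using pair_finite_verts by (simp add: N_def)
  have cardN: "card (N u) = d" if "u \<in> pverts G" for u
    using adj_row_sum[OF assms that] pair_finite_verts
    by (simp add: adj_def of_bool_def sum.If_cases Int_def N_def)
  obtain u v where uv: "(u, v) \<in> parcs G"
    using assms by (auto simp: srg_def)
  have u: "u \<in> pverts G" and v: "v \<in> pverts G"
    using uv by (auto dest: in_arcsD1 in_arcsD2)
  have "v \<in> N u - common_neighbors G u v"
    using uv v pair_no_loops[of "(v, v)"] by (auto simp: N_def common_neighbors_def)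
  moreover have "common_neighbors G u v \<subseteq> N u"
    by (auto simp: N_def common_neighbors_def)
  ultimately have "card (common_neighbors G u v) < card (N u)"
    by (intro psubset_card_mono finN) auto
  then show "lam < d"
    using assms uv u v cardN by (auto simp: srg_def)
  have "u \<notin> N u"
    using pair_no_loops[of "(u, u)"] by (auto simp: N_def)
  then have "card (N u) < card (pverts G)"
    using u pair_finite_verts by (intro psubset_card_mono) (auto simp: N_def)
  then show "d < n"
    using assms u cardN by (simp add: srg_def)
  have "graph (with_proj G)"
    by unfold_locales
  then have "parcs G \<noteq> {(u, v). (u, v) \<in> pverts G \<times> pverts G \<and> u \<noteq> v}"
    using assms by (auto simp: srg_def complete_digraph_def)
  moreover have "parcs G \<subseteq> {(u, v). (u, v) \<in> pverts G \<times> pverts G \<and> u \<noteq> v}"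
    using pair_no_loops[of "(x, x)" for x] by (auto dest: in_arcsD1 in_arcsD2)
  ultimately obtain x y where xy: "x \<in> pverts G" "y \<in> pverts G" "x \<noteq> y" "(x, y) \<notin> parcs G"
    by auto
  have "card (common_neighbors G x y) \<le> card (N x)"
    by (intro card_mono finN) (auto simp: N_def common_neighbors_def)
  then show "mu \<le> d"
    using assms xy cardN by (auto simp: srg_def)
qed

section \<open>Restricted eigenvalues\<close>

text \<open>
  The two roots of \<open>x\<^sup>2 - (\<lambda> - \<mu>) x - (d - \<mu>)\<close>, which are the eigenvalues of the adjacency
  matrix on the vectors orthogonal to the constant one.
\<close>

definition eig_max :: "nat \<Rightarrow> nat \<Rightarrow> nat \<Rightarrow> real" where
  "eig_max d lam mu =
    (real lam - real mu + sqrt ((real mu - real lam)\<^sup>2 + 4 * (real d - real mu))) / 2"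

definition eig_min :: "nat \<Rightarrow> nat \<Rightarrow> nat \<Rightarrow> real" where
  "eig_min d lam mu =
    (real lam - real mu - sqrt ((real mu - real lam)\<^sup>2 + 4 * (real d - real mu))) / 2"

text \<open>
  The strict negativity of the smaller root makes the quotients in the theorem meaningful. The bound
  \<open>\<mu> \<le> d\<close> alone gives only \<open>\<tau> \<le> 0\<close>; if \<open>\<mu> = d\<close>, then the smaller root is \<open>\<lambda> - d\<close>, and \<open>\<lambda> < d\<close> is needed.
\<close>

lemma eig_props:
  assumes "srg n d lam mu G"
  shows eig_sum: "eig_max d lam mu + eig_min d lam mu = real lam - real mu"
    and eig_prod: "eig_max d lam mu * eig_min d lam mu = real mu - real d"
    and eig_min_neg: "eig_min d lam mu < 0"
    and eig_max_nonneg: "eig_max d lam mu \<ge> 0"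
proof -
  have le: "lam < d" "mu \<le> d"
    using srg_bounds[OF assms] by auto
  let ?D = "(real mu - real lam)\<^sup>2 + 4 * (real d - real mu)"
  show "eig_max d lam mu + eig_min d lam mu = real lam - real mu"
    by (simp add: eig_max_def eig_min_def field_simps)
  have "sqrt ?D ^ 2 = ?D"
    using le by simp
  then show prod: "eig_max d lam mu * eig_min d lam mu = real mu - real d"
    unfolding eig_max_def eig_min_def by (simp add: field_simps power2_eq_square)
  have "\<bar>real mu - real lam\<bar> \<le> sqrt ?D"
    using le by (intro real_le_rsqrt) simp
  then show "eig_max d lam mu \<ge> 0"
    by (simp add: eig_max_def)
  show "eig_min d lam mu < 0"
  proof (cases "mu = d")
    case True
    then show ?thesis
      using le by (simp add: eig_min_def)
  next
    case False
    then have "\<bar>real mu - real lam\<bar> < sqrt ?D"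
      using le by (intro real_less_rsqrt) simp
    then show ?thesis
      by (simp add: eig_min_def)
  qed
qed

text \<open>
  Summing a row of \<open>A\<^sup>2 = (\<lambda> - \<mu>) A + (d - \<mu>) I + \<mu> J\<close> gives \<open>d\<^sup>2\<close> on the left-hand side.
\<close>

lemma srg_parameter_identity:
  assumes "srg n d lam mu G"
    and rs: "r + s = real lam - real mu" "r * s = real mu - real d"
  shows "(real d - r) * (real d - s) = real mu * real n"
proof -
  interpret pair_graph G using assms(1) by (simp add: srg_def regular_graph_def)
  let ?V = "pverts G"
  have n: "card ?V = n" and fin: "finite ?V"
    using assms(1) pair_finite_verts by (auto simp: srg_def)
  obtain u where u: "u \<in> ?V"
    using srg_bounds(3)[OF assms(1)] n by fastforce
  have "(\<Sum>v\<in>?V. \<Sum>w\<in>?V. adj G u w * adj G v w) = (\<Sum>w\<in>?V. \<Sum>v\<in>?V. adj G u w * adj G w v)"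
    by (subst sum.swap) (simp add: adj_simps(1)[OF pair_graph_axioms])
  also have "\<dots> = real d * real d"
    by (simp add: adj_row_sum[OF assms(1)] u flip: sum_distrib_left sum_distrib_right)
  finally have "real d * real d = (\<Sum>v\<in>?V. (real lam - real mu) * adj G u v
      + (real d - real mu) * of_bool (u = v) + real mu)"
    by (simp add: adj_square[OF assms(1) u])
  also have "\<dots> = (real lam - real mu) * real d + (real d - real mu) + real mu * real n"
    using u fin n
    by (simp add: sum.distrib adj_row_sum[OF assms(1)] sum_Kronecker_delta flip: sum_distrib_left)
  finally show ?thesis
    unfolding rs(1)[symmetric] using rs(2) by (simp add: algebra_simps)
qed

section \<open>Multiples of eigenspace projections\<close>

text \<open>
  If \<open>r, s\<close> are the restricted eigenvalues, then \<open>A - s I - (d - s)/n J\<close> annihilates the constant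
  vector; on the vectors orthogonal to it, the matrix is \<open>A - s I\<close>, which annihilates the eigenspace
  of \<open>s\<close> and acts as the scalar \<open>r - s\<close> on that of \<open>r\<close>. It is thus \<open>r - s\<close> times an orthogonal
  projection, whichever of the two roots is called \<open>s\<close>.
\<close>

definition eig_matrix :: "'a pair_pre_digraph \<Rightarrow> nat \<Rightarrow> real \<Rightarrow> 'a \<Rightarrow> 'a \<Rightarrow> real" where
  "eig_matrix G d s u v =
    adj G u v - s * of_bool (u = v) - (real d - s) / real (card (pverts G))"

lemma eig_matrix_row_sum:
  assumes "srg n d lam mu G" and u: "u \<in> pverts G"
  shows "(\<Sum>v\<in>pverts G. eig_matrix G d s u v) = 0"
proof -
  interpret pair_graph G using assms(1) by (simp add: srg_def regular_graph_def)
  have "pverts G \<noteq> {}"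
    using u by auto
  then show ?thesis
    using u pair_finite_verts
    by (simp add: eig_matrix_def sum_subtractf adj_row_sum[OF assms(1)] sum_Kronecker_delta
        flip: sum_distrib_left)
qed

text \<open>
  The coefficient of \<open>J\<close> in the square is \<open>\<mu> - (d - s)\<^sup>2/n\<close>, and by \<open>\<mu> n = (d - r) (d - s)\<close> this is
  \<open>-(r - s) (d - s)/n\<close>, as required.
\<close>

lemma eig_matrix_square:
  assumes "srg n d lam mu G" and u: "u \<in> pverts G" and v: "v \<in> pverts G"
    and rs: "r + s = real lam - real mu" "r * s = real mu - real d"
  shows "(\<Sum>w\<in>pverts G. eig_matrix G d s u w * eig_matrix G d s v w) =
    (r - s) * eig_matrix G d s u v"
proof -
  interpret pair_graph G using assms(1) by (simp add: srg_def regular_graph_def)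
  let ?V = "pverts G" and ?M = "eig_matrix G d s"
  define c where "c = (real d - s) / real n"
  have n: "card ?V = n" and fin: "finite ?V"
    using assms(1) pair_finite_verts by (auto simp: srg_def)
  have "n > 0"
    using srg_bounds(3)[OF assms(1)] by simp
  have M: "?M x y = adj G x y - s * of_bool (x = y) - c" for x y
    by (simp add: eig_matrix_def c_def n)
  \<comment> \<open>The rows of the matrix sum to zero, so its constant part may be dropped from one factor.\<close>
  have "(\<Sum>w\<in>?V. ?M u w * ?M v w) =
      (\<Sum>w\<in>?V. ?M u w * (adj G v w - s * of_bool (v = w))) - c * (\<Sum>w\<in>?V. ?M u w)"
    by (simp add: M[of v] sum_subtractf sum.distrib sum_distrib_left algebra_simps)
  also have "\<dots> = (\<Sum>w\<in>?V. ?M u w * adj G v w) - s * ?M u v"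
    using sum_Kronecker_delta(1)[OF fin v, of "?M u"]
    by (simp add: eig_matrix_row_sum[OF assms(1) u] right_diff_distrib sum_subtractf
        mult.left_commute[of _ s] flip: sum_distrib_left)
  also have "(\<Sum>w\<in>?V. ?M u w * adj G v w) =
      (\<Sum>w\<in>?V. adj G u w * adj G v w) - s * adj G v u - c * (\<Sum>w\<in>?V. adj G v w)"
    using sum_Kronecker_delta(2)[OF fin u, of "adj G v"]
    by (simp add: M left_diff_distrib sum_subtractf mult.assoc flip: sum_distrib_left)
  also have "\<dots> = (real lam - real mu) * adj G u v + (real d - real mu) * of_bool (u = v)
      + real mu - s * adj G u v - c * real d"
    by (simp add: adj_square[OF assms(1) u v] adj_row_sum[OF assms(1) v]
        adj_simps(1)[OF pair_graph_axioms, of v u])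
  also have "\<dots> = (r + s) * adj G u v - r * s * of_bool (u = v) + c * (real d - r)
      - s * adj G u v - c * real d"
    using srg_parameter_identity[OF assms(1) rs] \<open>n > 0\<close> by (simp add: rs c_def field_simps)
  finally show ?thesis
    by (simp add: M[of u v] algebra_simps)
qed

text \<open>
  The hypotheses are \<open>Z Z\<^sup>T = a Z\<close> and \<open>W W\<^sup>T = b W\<close>. Hence \<open>a b\<close> times the entrywise inner product of
  \<open>Z\<close> and \<open>W\<close> is the inner product of \<open>Z Z\<^sup>T\<close> and \<open>W W\<^sup>T\<close>, which is the squared Frobenius norm of
  \<open>Z\<^sup>T W\<close>. Allowing either sign of \<open>a\<close> and \<open>b\<close> saves negating a matrix.
\<close>

lemma projection_trace_sign:
  fixes Z W :: "'a \<Rightarrow> 'a \<Rightarrow> real"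
  assumes Z: "\<And>u v. u \<in> V \<Longrightarrow> v \<in> V \<Longrightarrow> (\<Sum>w\<in>V. Z u w * Z v w) = a * Z u v"
    and W: "\<And>u v. u \<in> V \<Longrightarrow> v \<in> V \<Longrightarrow> (\<Sum>w\<in>V. W u w * W v w) = b * W u v"
  shows "a * b * (\<Sum>u\<in>V. \<Sum>v\<in>V. Z u v * W u v) \<ge> 0"
proof -
  have "a * b * (\<Sum>u\<in>V. \<Sum>v\<in>V. Z u v * W u v) = (\<Sum>u\<in>V. \<Sum>v\<in>V. (a * Z u v) * (b * W u v))"
    by (simp add: sum_distrib_left mult_ac)
  also have "\<dots> = (\<Sum>u\<in>V. \<Sum>v\<in>V. (\<Sum>w\<in>V. Z u w * Z v w) * (\<Sum>x\<in>V. W u x * W v x))"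
    by (simp add: Z W)
  also have "\<dots> = (\<Sum>u\<in>V. \<Sum>v\<in>V. \<Sum>w\<in>V. \<Sum>x\<in>V. (Z u w * W u x) * (Z v w * W v x))"
    unfolding sum_product by (simp add: mult_ac)
  also have "\<dots> = (\<Sum>u\<in>V. \<Sum>w\<in>V. \<Sum>v\<in>V. \<Sum>x\<in>V. (Z u w * W u x) * (Z v w * W v x))"
    by (intro sum.cong refl sum.swap)
  also have "\<dots> = (\<Sum>w\<in>V. \<Sum>u\<in>V. \<Sum>x\<in>V. \<Sum>v\<in>V. (Z u w * W u x) * (Z v w * W v x))"
    by (subst sum.swap) (intro sum.cong refl sum.swap)
  also have "\<dots> = (\<Sum>w\<in>V. \<Sum>x\<in>V. \<Sum>u\<in>V. \<Sum>v\<in>V. (Z u w * W u x) * (Z v w * W v x))"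
    by (intro sum.cong refl sum.swap)
  also have "\<dots> = (\<Sum>w\<in>V. \<Sum>x\<in>V. (\<Sum>u\<in>V. Z u w * W u x)\<^sup>2)"
    by (simp add: power2_eq_square sum_product)
  also have "\<dots> \<ge> 0"
    by (intro sum_nonneg) simp
  finally show ?thesis .
qed

section \<open>Spanning subgraphs\<close>

text \<open>
  Where \<open>A'\<close> has an entry \<open>1\<close>, so has \<open>A\<close>, because \<open>H\<close> is a subgraph of \<open>G\<close>; so the product of a row
  of the matrix of \<open>G\<close> with the same row of \<open>A'\<close> is \<open>d'\<close> times its value on an edge. The identity part
  of the second matrix picks the diagonal entry of the first, and the constant part contributes
  nothing because the rows of the first matrix sum to zero.
\<close>

lemma eig_matrix_inner_row:
  assumes G: "srg n d lam mu G" and H: "srg n d' lam' mu' H"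
    and V: "pverts H = pverts G" and sub: "parcs H \<subseteq> parcs G" and u: "u \<in> pverts G"
  shows "(\<Sum>v\<in>pverts G. eig_matrix G d r u v * eig_matrix H d' t u v) =
    real d' * (1 - (real d - r) / real n) + t * (r + (real d - r) / real n)"
proof -
  interpret G: pair_graph G using G by (simp add: srg_def regular_graph_def)
  let ?V = "pverts G" and ?M = "eig_matrix G d r"
  define c where "c = (real d - r) / real n"
  define e where "e = (real d' - t) / real n"
  have n: "card ?V = n" and fin: "finite ?V"
    using G G.pair_finite_verts by (auto simp: srg_def)
  have "pair_graph H"
    using H by (simp add: srg_def regular_graph_def)
  have M: "?M x y = adj G x y - r * of_bool (x = y) - c" for x y
    by (simp add: eig_matrix_def c_def n)
  have entry: "?M u v * adj H u v = (1 - c) * adj H u v" for v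
    using sub adj_simps(2)[OF \<open>pair_graph H\<close>, of u] by (cases "u = v") (auto simp: M adj_def)
  have "(\<Sum>v\<in>?V. ?M u v * eig_matrix H d' t u v) =
      (\<Sum>v\<in>?V. ?M u v * adj H u v) - t * (\<Sum>v\<in>?V. ?M u v * of_bool (u = v))
      - e * (\<Sum>v\<in>?V. ?M u v)"
    by (simp add: eig_matrix_def[of H] V n e_def[symmetric] right_diff_distrib sum_subtractf
        sum_distrib_left mult.left_commute[of _ t] mult.commute[of _ e]
        del: sum_mult_of_bool_eq)
  also have "\<dots> = (1 - c) * (\<Sum>v\<in>?V. adj H u v) - t * ?M u u"
    using sum_Kronecker_delta(1)[OF fin u, of "?M u"]
    by (simp add: entry eig_matrix_row_sum[OF G u] flip: sum_distrib_left)
  also have "\<dots> = (1 - c) * real d' + t * (r + c)"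
    using adj_row_sum[OF H, of u] u
    by (simp add: V M adj_simps(2)[OF G.pair_graph_axioms] algebra_simps)
  finally show ?thesis
    by (simp add: c_def mult_ac)
qed

text \<open>
  In terms of the smaller roots, this is \<open>d' / (-\<tau>') \<le> d / (-\<tau>)\<close> with denominators cleared.
\<close>

lemma spanning_srg_ratio:
  assumes G: "srg n d lam mu G" and H: "srg n d' lam' mu' H"
    and V: "pverts H = pverts G" and sub: "parcs H \<subseteq> parcs G"
  shows "real d' * - eig_min d lam mu \<le> real d * - eig_min d' lam' mu'"
proof -
  let ?V = "pverts G"
  define r s r' s' where "r = eig_max d lam mu" and "s = eig_min d lam mu"
    and "r' = eig_max d' lam' mu'" and "s' = eig_min d' lam' mu'"
  note defs = r_def s_def r'_def s'_def
  have rs: "r + s = real lam - real mu" "r * s = real mu - real d" "s < 0" "r \<ge> 0"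
    using eig_props[OF G] by (auto simp: defs)
  have rs': "r' + s' = real lam' - real mu'" "r' * s' = real mu' - real d'" "s' < 0" "r' \<ge> 0"
    using eig_props[OF H] by (auto simp: defs)
  have card: "card ?V = n"
    using G by (simp add: srg_def)
  have n: "real n > 0" and dn: "real d < real n"
    using srg_bounds(3)[OF G] by auto
  define T where
    "T = real d' * (1 - (real d - r) / real n) + s' * (r + (real d - r) / real n)"
  \<comment> \<open>For \<open>G\<close> the projection onto the eigenspace of the smaller root is taken, for \<open>H\<close> onto that of
      the larger one. The first multiple \<open>s - r\<close> is negative, so the double sum is at most \<open>0\<close>.\<close>
  have "(s - r) * (r' - s') *
      (\<Sum>u\<in>?V. \<Sum>v\<in>?V. eig_matrix G d r u v * eig_matrix H d' s' u v) \<ge> 0"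
  proof (rule projection_trace_sign)
    show "(\<Sum>w\<in>?V. eig_matrix G d r u w * eig_matrix G d r v w) = (s - r) * eig_matrix G d r u v"
      if "u \<in> ?V" "v \<in> ?V" for u v
      using eig_matrix_square[OF G that, of s r] rs by (simp add: add.commute mult.commute)
    show "(\<Sum>w\<in>?V. eig_matrix H d' s' u w * eig_matrix H d' s' v w) =
        (r' - s') * eig_matrix H d' s' u v"
      if "u \<in> ?V" "v \<in> ?V" for u v
      using eig_matrix_square[OF H, of u v r' s'] that rs' by (simp add: V)
  qed
  also have "(\<Sum>u\<in>?V. \<Sum>v\<in>?V. eig_matrix G d r u v * eig_matrix H d' s' u v) = real n * T"
    by (simp add: eig_matrix_inner_row[OF G H V sub] T_def card)
  finally have "(s - r) * (r' - s') * real n * T \<ge> 0"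
    by (simp add: mult_ac)
  moreover have "(s - r) * (r' - s') * real n < 0"
    using rs rs' n by (intro mult_neg_pos) auto
  ultimately have "T \<le> 0"
    by (metis less_le_not_le linorder_not_le mult_neg_pos)
  then have "real n * T \<le> 0"
    using n by (simp add: mult_le_0_iff)
  moreover have "real n * T = real d' * (real n - (real d - r)) + s' * (r * real n + (real d - r))"
    using n by (simp add: T_def field_simps)
  ultimately have main: "real d' * (real n - (real d - r)) \<le> - s' * (r * real n + (real d - r))"
    by simp
  \<comment> \<open>The parameter identity turns the right-hand side into a multiple of the same factor
      \<open>n - d + r\<close> as on the left.\<close>
  have fac: "- s * (r * real n + (real d - r)) = real d * (real n - (real d - r))"
    using srg_parameter_identity[OF G rs(1,2)] rs(2) by algebra
  have "(real d' * - s) * (real n - (real d - r)) = - s * (real d' * (real n - (real d - r)))"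
    by (simp add: mult_ac)
  also have "\<dots> \<le> - s * (- s' * (r * real n + (real d - r)))"
    using main rs(3) by (intro mult_left_mono) auto
  also have "\<dots> = - s' * (- s * (r * real n + (real d - r)))"
    by (simp add: mult_ac)
  also have "\<dots> = (real d * - s') * (real n - (real d - r))"
    unfolding fac by (simp add: mult_ac)
  finally show ?thesis
    using dn rs(4) by (simp add: defs mult_le_cancel_right)
qed

theorem corollary4p1:
  fixes G H :: "'a pair_pre_digraph"
    and n d lam mu d' lam' mu' :: nat
  assumes "srg n d lam mu G"
    and "srg n d' lam' mu' H"
    and "spanning (with_proj H) (with_proj G)"
  shows "real d / real d' *
    ((real mu' - real lam' + sqrt ((real mu' - real lam')\<^sup>2 + 4 * (real d' - real mu'))) /
     (real mu - real lam + sqrt ((real mu - real lam)\<^sup>2 + 4 * (real d - real mu)))) \<ge> 1"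
proof -
  have "pverts H = pverts G" "parcs H \<subseteq> parcs G"
    using assms(3) by (auto simp: spanning_def subgraph_def)
  note ratio = spanning_srg_ratio[OF assms(1,2) this]
  have pos: "real d' * - eig_min d lam mu > 0"
    using eig_min_neg[OF assms(1)] srg_bounds(1)[OF assms(2)] by (simp add: mult_pos_neg)
  have eq: "real m - real l + sqrt ((real m - real l)\<^sup>2 + 4 * (real k - real m)) =
      2 * - eig_min k l m" for k l m
    by (simp add: eig_min_def field_simps)
  have "real d / real d' * ((2 * - eig_min d' lam' mu') / (2 * - eig_min d lam mu)) =
      (real d * - eig_min d' lam' mu') / (real d' * - eig_min d lam mu)"
    by simp
  also have "\<dots> \<ge> 1"
    using ratio pos by (subst le_divide_eq_1_pos) auto
  finally show ?thesis
    unfolding eq .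
qed

end
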